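(* The dual-grid configuration $Z_{3,3}$ is orthogonally equivalent to the Cabello $18$--$9$ configuration. More precisely, there are mutually polar trisecants $L\subset D$ and $L'\subset D'$ in the two $D_4$ components of the Peres configuration such that $Z_{3,3}$ is orthogonally equivalent to $(D\setminus L)\sqcup(D'\setminus L')$. Under this equivalence, the two grids are supported on Euclidean-dual quadrics, and the nine contexts $C_{ij}$, $(i,j)\in\mathbb Z_3\times\mathbb Z_3$, correspond to the nine contexts of the Cabello parity proof.
   Context: Work in $\mathbb R^4=\mathbb R^2\oplus\mathbb R^2$ with the standard Euclidean inner product; rays are points of $\mathbb P^3(\mathbb R)$. Two sets of rays are orthogonally equivalent if some element of $O(4)$ maps one onto the other. An orthogonal context is a set of four pairwise orthogonal rays. If a smooth quadric is $Q=\{x^tMx=0\}$, with $M$ a symmetric invertible real matrix, its Euclidean dual is $\{y^tM^{-1}y=0\}$. $Z_{3,3}$: let $\alpha=\beta=2\pi/3$, $c=\sqrt2$ (cyclic steps $a=b=1$), $u(\theta)=(\cos\theta,\sin\theta)$, and for $(i,j)\in\mathbb Z_3\times\mathbb Z_3$ let $A_{ij}=[u(i\alpha-j\beta),-c\,u(i\alpha+j\beta)]$, $B_{ij}=[c\,u(i\alpha-j\beta),u(i\alpha+j\beta)]$. Then $Z_{3,3}=A\sqcup B$ with $A=\{A_{ij}\}$, $B=\{B_{ij}\}$ (the two grids, each being the nine intersection points of three lines of one ruling with three lines of the other ruling of a smooth quadric), and $C_{ij}=\{A_{ij},A_{i-1,j-1},B_{i,j-1},B_{i-1,j}\}$. Peres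 configuration $D\sqcup D'$, with $D=\{P_1,\dots,P_{12}\}$ and $D'=\{P_{13},\dots,P_{24}\}$ (each a projectivized $D_4$ root configuration), the rays being spanned by: $P_1=(1,0,0,0)$, $P_2=(0,1,0,0)$, $P_3=(0,0,1,0)$, $P_4=(0,0,0,1)$, $P_5=(1,1,1,1)$, $P_6=(1,1,-1,-1)$, $P_7=(1,-1,1,-1)$, $P_8=(1,-1,-1,1)$, $P_9=(1,1,1,-1)$, $P_{10}=(1,1,-1,1)$, $P_{11}=(1,-1,1,1)$, $P_{12}=(1,-1,-1,-1)$, $P_{13}=(1,1,0,0)$, $P_{14}=(1,-1,0,0)$, $P_{15}=(0,0,1,1)$, $P_{16}=(0,0,1,-1)$, $P_{17}=(0,1,0,1)$, $P_{18}=(0,1,0,-1)$, $P_{19}=(1,0,1,0)$, $P_{20}=(1,0,-1,0)$, $P_{21}=(1,0,0,1)$, $P_{22}=(1,0,0,-1)$, $P_{23}=(0,1,1,0)$, $P_{24}=(0,1,-1,0)$. A trisecant of $D$ (or $D'$) is the set of three points of $D$ (or $D'$) on a projective line containing exactly three of its points. Trisecants $L\subset D$, $L'\subset D'$ are mutually polar if every ray of $L$ is orthogonal to every ray of $L'$. The Cabello $18$--$9$ configuration (Cabello, Estebaranz, Garc\'ia-Alcaine) is, up to orthogonal equivalence, the set of $18$ rays occurring in the following nine orthogonal contexts (the contexts of its parity proof): $\{P_2,P_3,P_{21},P_{22}\}$, $\{P_9,P_{10},P_{14},P_{15}\}$, $\{P_6,P_8,P_{17},P_{19}\}$, $\{P_7,P_8,P_{13},P_{15}\}$,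 $\{P_2,P_4,P_{19},P_{20}\}$, $\{P_{10},P_{11},P_{22},P_{23}\}$, $\{P_9,P_{11},P_{17},P_{20}\}$, $\{P_6,P_7,P_{21},P_{23}\}$, $\{P_3,P_4,P_{13},P_{14}\}$. *)

theory Defs
  imports "HOL-Analysis.Analysis"
begin

text \<open>
  A ray, i.e. a point of the real projective space \<open>P\<^sup>3\<close>, is the line
  \<open>span {v}\<close> through the origin spanned by a nonzero vector \<open>v\<close>; a projective line is
  a two-dimensional linear subspace, containing the rays that are subsets of it.
\<close>

type_synonym ray = "(real^4) set"

definition ray :: "real^4 \<Rightarrow> ray" where
  "ray v = span {v}"

definition ray_orthogonal :: "ray \<Rightarrow> ray \<Rightarrow> bool" where
  "ray_orthogonal r s \<longleftrightarrow> (\<forall>x\<in>r. \<forall>y\<in>s. orthogonal x y)"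

definition proj_line :: "(real^4) set \<Rightarrow> bool" where
  "proj_line W \<longleftrightarrow> subspace W \<and> dim W = 2"

definition transform_rays :: "real^4^4 \<Rightarrow> ray set \<Rightarrow> ray set" where
  "transform_rays U S = (\<lambda>r. (*v) U ` r) ` S"

definition orthogonally_equivalent :: "ray set \<Rightarrow> ray set \<Rightarrow> bool" where
  "orthogonally_equivalent S T \<longleftrightarrow> (\<exists>U. orthogonal_matrix U \<and> transform_rays U S = T)"


subsection \<open>Quadrics and grids\<close>

definition smooth_quadric :: "real^4^4 \<Rightarrow> bool" where
  "smooth_quadric M \<longleftrightarrow> transpose M = M \<and> invertible M"

text \<open>The affine cone over the projective quadric with matrix \<open>M\<close>. The Euclidean dual of
  this quadric is \<open>quadric (matrix_inv M)\<close>.\<close>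

definition quadric :: "real^4^4 \<Rightarrow> (real^4) set" where
  "quadric M = {x. x \<bullet> (M *v x) = 0}"

text \<open>Two projective lines contained in a smooth quadric belong to the same ruling iff they
  are equal or skew; skew means that the subspaces meet only in the origin.\<close>

definition same_ruling :: "(real^4) set \<Rightarrow> (real^4) set \<Rightarrow> bool" where
  "same_ruling V W \<longleftrightarrow> V = W \<or> V \<inter> W = {0}"

text \<open>The set \<open>S\<close> consists of the nine intersection points of three lines of one ruling with
  three lines of the other ruling of the quadric with matrix \<open>M\<close>. Lines of opposite rulings
  are distinct and meet, so that each \<open>V \<inter> W\<close> below is a ray.\<close>

definition grid_on_quadric :: "real^4^4 \<Rightarrow> ray set \<Rightarrow> bool" where
  "grid_on_quadric M S \<longleftrightarrow>
     (\<exists>\<V> \<W>. card \<V> = 3 \<and> card \<W> = 3 \<and>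
        (\<forall>V\<in>\<V> \<union> \<W>. proj_line V \<and> V \<subseteq> quadric M) \<and>
        (\<forall>V\<in>\<V>. \<forall>V'\<in>\<V>. same_ruling V V') \<and>
        (\<forall>W\<in>\<W>. \<forall>W'\<in>\<W>. same_ruling W W') \<and>
        (\<forall>V\<in>\<V>. \<forall>W\<in>\<W>. \<not> same_ruling V W) \<and>
        S = {V \<inter> W | V W. V \<in> \<V> \<and> W \<in> \<W>})"


subsection \<open>The dual-grid configuration\<close>

definition unit_vec :: "real \<Rightarrow> real^2" where
  "unit_vec \<theta> = vector [cos \<theta>, sin \<theta>]"

definition join_vec :: "real^2 \<Rightarrow> real^2 \<Rightarrow> real^4" where
  "join_vec x y = vector [x $ 1, x $ 2, y $ 1, y $ 2]"

definition alpha :: real where "alpha = 2 * pi / 3"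
definition beta :: real where "beta = 2 * pi / 3"
definition cc :: real where "cc = sqrt 2"

text \<open>The indices in \<open>\<int>/3\<close> are represented by integers; the rays depend only on the
  residues of the indices modulo 3 (see \<open>grid_A_mod\<close>, \<open>grid_B_mod\<close>).\<close>

definition grid_A :: "int \<Rightarrow> int \<Rightarrow> ray" where
  "grid_A i j = ray (join_vec (unit_vec (of_int i * alpha - of_int j * beta))
                              (- cc *\<^sub>R unit_vec (of_int i * alpha + of_int j * beta)))"

definition grid_B :: "int \<Rightarrow> int \<Rightarrow> ray" where
  "grid_B i j = ray (join_vec (cc *\<^sub>R unit_vec (of_int i * alpha - of_int j * beta))
                              (unit_vec (of_int i * alpha + of_int j * beta)))"

lemma unit_vec_shift: "unit_vec (t + of_int k * (2 * pi)) = unit_vec t"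
proof -
  have "cos (t + of_int k * (2 * pi)) = cos t" "sin (t + of_int k * (2 * pi)) = sin t"
    using cos_int_2pin[of k] sin_int_2pin[of k]
    by (simp_all add: cos_add sin_add mult.commute)
  then show ?thesis by (simp add: unit_vec_def)
qed

lemma unit_vec_mod:
  "unit_vec (of_int (i mod 3) * alpha - of_int (j mod 3) * beta) =
     unit_vec (of_int i * alpha - of_int j * beta)"
  "unit_vec (of_int (i mod 3) * alpha + of_int (j mod 3) * beta) =
     unit_vec (of_int i * alpha + of_int j * beta)"
proof -
  have m: "(of_int (k mod 3) :: real) = of_int k - 3 * of_int (k div 3)" for k :: int
    by (metis minus_mult_div_eq_mod of_int_diff of_int_mult of_int_numeral)
  have "of_int (i mod 3) * alpha - of_int (j mod 3) * beta =
      of_int i * alpha - of_int j * beta + of_int (j div 3 - i div 3) * (2 * pi)"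
    unfolding m alpha_def beta_def by (simp add: algebra_simps)
  then show "unit_vec (of_int (i mod 3) * alpha - of_int (j mod 3) * beta) =
     unit_vec (of_int i * alpha - of_int j * beta)"
    by (simp only: unit_vec_shift)
  have "of_int (i mod 3) * alpha + of_int (j mod 3) * beta =
      of_int i * alpha + of_int j * beta + of_int (- (j div 3) - i div 3) * (2 * pi)"
    unfolding m alpha_def beta_def by (simp add: algebra_simps)
  then show "unit_vec (of_int (i mod 3) * alpha + of_int (j mod 3) * beta) =
     unit_vec (of_int i * alpha + of_int j * beta)"
    by (simp only: unit_vec_shift)
qed

lemma grid_A_mod: "grid_A (i mod 3) (j mod 3) = grid_A i j"
  by (simp only: grid_A_def unit_vec_mod)

lemma grid_B_mod: "grid_B (i mod 3) (j mod 3) = grid_B i j"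
  by (simp only: grid_B_def unit_vec_mod)

definition Z3xZ3 :: "(int \<times> int) set" where
  "Z3xZ3 = {0, 1, 2} \<times> {0, 1, 2}"

definition A_rays :: "ray set" where
  "A_rays = (\<lambda>(i, j). grid_A i j) ` Z3xZ3"

definition B_rays :: "ray set" where
  "B_rays = (\<lambda>(i, j). grid_B i j) ` Z3xZ3"

definition Z33 :: "ray set" where
  "Z33 = A_rays \<union> B_rays"

definition context_C :: "int \<Rightarrow> int \<Rightarrow> ray set" where
  "context_C i j = {grid_A i j, grid_A (i - 1) (j - 1), grid_B i (j - 1), grid_B (i - 1) j}"


subsection \<open>The Peres and Cabello configurations\<close>

text \<open>\<open>peres k\<close> is the ray \<open>P\<^sub>k\<close>, for \<open>k\<close> from 1 to 24.\<close>

definition peres :: "nat \<Rightarrow> ray" where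
  "peres k = ray (
     [vector [1, 0, 0, 0], vector [0, 1, 0, 0], vector [0, 0, 1, 0], vector [0, 0, 0, 1],
      vector [1, 1, 1, 1], vector [1, 1, -1, -1], vector [1, -1, 1, -1], vector [1, -1, -1, 1],
      vector [1, 1, 1, -1], vector [1, 1, -1, 1], vector [1, -1, 1, 1], vector [1, -1, -1, -1],
      vector [1, 1, 0, 0], vector [1, -1, 0, 0], vector [0, 0, 1, 1], vector [0, 0, 1, -1],
      vector [0, 1, 0, 1], vector [0, 1, 0, -1], vector [1, 0, 1, 0], vector [1, 0, -1, 0],
      vector [1, 0, 0, 1], vector [1, 0, 0, -1], vector [0, 1, 1, 0], vector [0, 1, -1, 0]]
     ! (k - 1))"

definition peres_D :: "ray set" where
  "peres_D = peres ` {1..12}"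

definition peres_D' :: "ray set" where
  "peres_D' = peres ` {13..24}"

definition trisecant :: "ray set \<Rightarrow> ray set \<Rightarrow> bool" where
  "trisecant S L \<longleftrightarrow> card L = 3 \<and> (\<exists>W. proj_line W \<and> L = {r \<in> S. r \<subseteq> W})"

definition mutually_polar :: "ray set \<Rightarrow> ray set \<Rightarrow> bool" where
  "mutually_polar L L' \<longleftrightarrow> (\<forall>r\<in>L. \<forall>s\<in>L'. ray_orthogonal r s)"

definition cabello_contexts :: "ray set set" where
  "cabello_contexts = (`) peres `
     {{2, 3, 21, 22}, {9, 10, 14, 15}, {6, 8, 17, 19},
      {7, 8, 13, 15}, {2, 4, 19, 20}, {10, 11, 22, 23},
      {9, 11, 17, 20}, {6, 7, 21, 23}, {3, 4, 13, 14}}"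

definition cabello_rays :: "ray set" where
  "cabello_rays = \<Union> cabello_contexts"

end

theory Submission
  imports Defs
begin

text \<open>The grids \<open>A\<close> and \<open>B\<close> lie on \<open>|y|\<^sup>2 = k\<^sup>2 |x|\<^sup>2\<close> with \<open>k = -\<surd>2\<close> and \<open>k = 1/\<surd>2\<close>, which are dual to each
  other. The two rulings of this quadric are the graphs of \<open>k\<close> times a rotation and of \<open>k\<close> times a
  reflection; a rotation and a reflection of the plane agree on exactly one line, which gives the
  rays of the grid. On the other side, the mutually polar trisecants \<open>{P\<^sub>1, P\<^sub>5, P\<^sub>1\<^sub>2}\<close> and
  \<open>{P\<^sub>1\<^sub>6, P\<^sub>1\<^sub>8, P\<^sub>2\<^sub>4}\<close> span orthogonal planes onto which the remaining Peres rays project in trines,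
  so an isometry matching these planes with the two summands carries \<open>Z\<^sub>3\<^sub>,\<^sub>3\<close> to the Cabello rays.\<close>

section \<open>Coordinates, rays and projective lines\<close>

lemma vector_4:
  "(vector [a, b, c, d] :: 'a::zero ^ 4) $ 1 = a"
  "(vector [a, b, c, d] :: 'a::zero ^ 4) $ 2 = b"
  "(vector [a, b, c, d] :: 'a::zero ^ 4) $ 3 = c"
  "(vector [a, b, c, d] :: 'a::zero ^ 4) $ 4 = d"
  by (simp_all add: vector_def)

lemmas coords4 = vec_eq_iff forall_4 vector_4
lemmas matrix4 = matrix_vector_mult_def matrix_matrix_mult_def sum_4 transpose_def mat_def

lemma mem_ray: "x \<in> ray v \<longleftrightarrow> (\<exists>c. x = c *\<^sub>R v)"
  by (auto simp: ray_def span_singleton)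

lemma ray_scaleR: "c \<noteq> 0 \<Longrightarrow> ray (c *\<^sub>R v) = ray v"
  using span_image_scale[of "{v}" "\<lambda>_. c"] by (simp add: ray_def)

lemma image_ray: "(*v) U ` ray v = ray (U *v v)"
  unfolding ray_def by (simp flip: linear_span_image[OF matrix_vector_mul_linear])

lemma ray_orthogonal_ray: "ray_orthogonal (ray v) (ray w) \<longleftrightarrow> v \<bullet> w = 0"
proof -
  have "v \<in> ray v" "w \<in> ray w" by (auto simp: ray_def span_base)
  then have "v \<bullet> w = 0" if "ray_orthogonal (ray v) (ray w)"
    using that unfolding ray_orthogonal_def orthogonal_def by blast
  then show ?thesis
    by (auto simp: ray_orthogonal_def mem_ray orthogonal_def)
qed

lemma ray_subset_iff: "subspace W \<Longrightarrow> ray v \<subseteq> W \<longleftrightarrow> v \<in> W"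
  by (auto simp: subset_iff mem_ray subspace_scale intro: exI[of _ 1])

lemma proj_line_image:
  fixes f :: "'a::euclidean_space \<Rightarrow> real^4"
  assumes "linear f" "inj_on f V" "subspace V" "dim V = 2"
  shows "proj_line (f ` V)"
proof -
  have "span V = V" using assms(3) by (rule span_eq_iff[THEN iffD2])
  then have "dim (f ` V) = dim V"
    using assms(1,2) by (intro dim_image_eq) (simp_all only:)
  then show ?thesis
    using assms by (simp add: proj_line_def linear_subspace_image)
qed

text \<open>A span of one vector has dimension at most 1. The case \<open>v = 0\<close> is included,
  so the same fact separates a line from \<open>{0}\<close>.\<close>

lemma proj_line_ne_ray: "proj_line V \<Longrightarrow> V \<noteq> ray v"
proof
  assume "proj_line V" "V = ray v"
  then have "dim (span {v}) = 2" by (simp add: proj_line_def ray_def)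
  then show False by (simp split: if_splits)
qed

section \<open>Lines on the quadrics\<close>

text \<open>The form k^2 |x|^2 - |y|^2 on the sum of two planes. Fixing the last two entries at -1
  keeps the family closed under inversion, with k going to 1/k.\<close>

definition clifford_quadric :: "real \<Rightarrow> real^4^4" where
  "clifford_quadric k = vector [vector [k\<^sup>2, 0, 0, 0], vector [0, k\<^sup>2, 0, 0],
                                vector [0, 0, -1, 0], vector [0, 0, 0, -1]]"

text \<open>The graph of \<open>k\<close> times the rotation by \<open>\<phi>\<close> if \<open>\<epsilon> = 1\<close>, and of \<open>k\<close> times the reflection
  taking angle \<open>s\<close> to angle \<open>\<phi> - s\<close> if \<open>\<epsilon> = -1\<close>; the sign \<open>\<epsilon>\<close> distinguishes the two rulings.\<close>

definition ruling_line :: "real \<Rightarrow> real \<Rightarrow> real \<Rightarrow> (real^4) set" where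
  "ruling_line \<epsilon> k \<phi> = {x. x $ 3 = k * (cos \<phi> * x $ 1 - \<epsilon> * sin \<phi> * x $ 2) \<and>
                            x $ 4 = k * (sin \<phi> * x $ 1 + \<epsilon> * cos \<phi> * x $ 2)}"

lemma proj_line_ruling_line: "proj_line (ruling_line \<epsilon> k \<phi>)"
proof -
  let ?f = "\<lambda>x::real^2. vector [x $ 1, x $ 2, k * (cos \<phi> * x $ 1 - \<epsilon> * sin \<phi> * x $ 2),
                                k * (sin \<phi> * x $ 1 + \<epsilon> * cos \<phi> * x $ 2)] :: real^4"
  have "x \<in> range ?f" if "x \<in> ruling_line \<epsilon> k \<phi>" for x
    using that by (intro range_eqI[of _ _ "vector [x $ 1, x $ 2]"])
      (simp add: ruling_line_def coords4)
  then have "ruling_line \<epsilon> k \<phi> = range ?f"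
    by (auto simp: ruling_line_def vector_4)
  moreover have "linear ?f"
    by (rule linearI) (simp_all add: coords4 algebra_simps)
  moreover have "inj ?f"
    by (rule injI) (auto simp: coords4 forall_2)
  ultimately show ?thesis
    using proj_line_image[of ?f UNIV] by simp
qed

lemma ruling_line_subset_quadric:
  assumes "\<epsilon> = 1 \<or> \<epsilon> = -1"
  shows "ruling_line \<epsilon> k \<phi> \<subseteq> quadric (clifford_quadric k)"
proof
  fix x assume x: "x \<in> ruling_line \<epsilon> k \<phi>"
  let ?a = "x $ 1" and ?b = "x $ 2" and ?c = "cos \<phi>" and ?s = "sin \<phi>"
  \<comment> \<open>A polynomial identity in which sine and cosine are independent variables; sin^2
    + cos^2 = 1 and \<epsilon>^2 = 1 enter only in the next step.\<close>
  have "(k * (?c * ?a - \<epsilon> * ?s * ?b))\<^sup>2 + (k * (?s * ?a + \<epsilon> * ?c * ?b))\<^sup>2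
      = k\<^sup>2 * (?s\<^sup>2 + ?c\<^sup>2) * (?a\<^sup>2 + \<epsilon>\<^sup>2 * ?b\<^sup>2)"
    by algebra
  with x assms have "(x $ 3)\<^sup>2 + (x $ 4)\<^sup>2 = k\<^sup>2 * (?a\<^sup>2 + ?b\<^sup>2)"
    by (auto simp: ruling_line_def)
  then show "x \<in> quadric (clifford_quadric k)"
    by (simp add: quadric_def clifford_quadric_def inner_vec_def matrix4 vector_4
        power2_eq_square algebra_simps)
qed

text \<open>In the coordinates (x1, \<epsilon> x2), read as a complex number, the difference of the
  two graph maps is multiplication by k (p + iq) with p, q the differences of cosines and sines.
  This is injective unless p = q = 0.\<close>

lemma ruling_line_disjoint:
  assumes "\<epsilon> = 1 \<or> \<epsilon> = -1" "k \<noteq> 0" and ne: "cos \<phi> \<noteq> cos \<psi> \<or> sin \<phi> \<noteq> sin \<psi>"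
  shows "ruling_line \<epsilon> k \<phi> \<inter> ruling_line \<epsilon> k \<psi> = {0}"
proof -
  have "x = 0" if "x \<in> ruling_line \<epsilon> k \<phi>" "x \<in> ruling_line \<epsilon> k \<psi>" for x
  proof -
    let ?p = "cos \<phi> - cos \<psi>" and ?q = "sin \<phi> - sin \<psi>" and ?a = "x $ 1" and ?b = "\<epsilon> * x $ 2"
    have "k * (?p * ?a - ?q * ?b) = 0" "k * (?q * ?a + ?p * ?b) = 0"
      using that by (auto simp: ruling_line_def algebra_simps)
    with assms(2) have e: "?p * ?a - ?q * ?b = 0" "?q * ?a + ?p * ?b = 0"
      by (simp_all only: mult_eq_0_iff simp_thms)
    \<comment> \<open>Multiplication by the conjugate p - iq.\<close>
    have "(?p\<^sup>2 + ?q\<^sup>2) * ?a = 0" "(?p\<^sup>2 + ?q\<^sup>2) * ?b = 0"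
      using e by algebra+
    moreover have "?p\<^sup>2 + ?q\<^sup>2 \<noteq> 0" using ne by (simp add: sum_power2_eq_zero_iff)
    ultimately have "?a = 0" "?b = 0" by auto
    with that assms(1) show ?thesis by (auto simp: ruling_line_def coords4)
  qed
  then show ?thesis by (auto simp: ruling_line_def)
qed

text \<open>The rotation by t - s and the reflection taking each angle r to (s + t) - r both send
  angle s to angle t. Conversely, where they agree, the component orthogonal to the direction s
  vanishes.\<close>

lemma ruling_line_Int:
  assumes "k \<noteq> 0"
  shows "ruling_line 1 k (t - s) \<inter> ruling_line (-1) k (s + t)
    = ray (join_vec (unit_vec s) (k *\<^sub>R unit_vec t))"
    (is "?V \<inter> ?W = ray ?v")
proof
  have "cos t = cos (t - s) * cos s - sin (t - s) * sin s"
    "sin t = sin (t - s) * cos s + cos (t - s) * sin s"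
    "cos t = cos (s + t) * cos s + sin (s + t) * sin s"
    "sin t = sin (s + t) * cos s - cos (s + t) * sin s"
    by (simp_all flip: cos_add sin_add cos_diff sin_diff)
  then have "c * (k * cos t) = k * (cos (t - s) * (c * cos s) - sin (t - s) * (c * sin s)) \<and>
    c * (k * sin t) = k * (sin (t - s) * (c * cos s) + cos (t - s) * (c * sin s)) \<and>
    c * (k * cos t) = k * (cos (s + t) * (c * cos s) + sin (s + t) * (c * sin s)) \<and>
    c * (k * sin t) = k * (sin (s + t) * (c * cos s) - cos (s + t) * (c * sin s))" for c
    by (intro conjI; algebra)
  then show "ray ?v \<subseteq> ?V \<inter> ?W"
    unfolding subset_iff mem_ray ruling_line_def join_vec_def unit_vec_def
    by clarify (simp del: mult_cancel_left add: vector_4)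
next
  show "?V \<inter> ?W \<subseteq> ray ?v"
  proof
    fix x assume x: "x \<in> ?V \<inter> ?W"
    let ?a = "x $ 1" and ?b = "x $ 2"
    \<comment> \<open>The component of (a, b) along the direction s; it becomes the scalar that
      exhibits x as a multiple of \<open>?v\<close>.\<close>
    define r where "r = cos s * ?a + sin s * ?b"
    have "cos (t - s) * ?a - sin (t - s) * ?b = cos (s + t) * ?a + sin (s + t) * ?b"
      "sin (t - s) * ?a + cos (t - s) * ?b = sin (s + t) * ?a - cos (s + t) * ?b"
      using x assms by (auto simp: ruling_line_def)
    \<comment> \<open>After the addition formulas the two differences are, up to a factor of 2 or
      -2, sin t and cos t times the component orthogonal to the direction s.\<close>
    then have "sin t * (sin s * ?a - cos s * ?b) = 0" "cos t * (sin s * ?a - cos s * ?b) = 0"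
      unfolding cos_add sin_add cos_diff sin_diff by algebra+
    moreover have "sin t \<noteq> 0 \<or> cos t \<noteq> 0"
      using sin_zero_abs_cos_one[of t] by auto
    ultimately have "sin s * ?a - cos s * ?b = 0"
      by (auto simp only: mult_eq_0_iff)
    then have e: "sin s * ?a = cos s * ?b" by simp
    have "?a = (sin s)\<^sup>2 * ?a + (cos s)\<^sup>2 * ?a" "?b = (sin s)\<^sup>2 * ?b + (cos s)\<^sup>2 * ?b"
      by (simp_all flip: distrib_right)
    then have ab: "?a = r * cos s" "?b = r * sin s"
      using e unfolding r_def by algebra+
    have "x $ 3 = k * (cos (t - s) * ?a - sin (t - s) * ?b)"
      "x $ 4 = k * (sin (t - s) * ?a + cos (t - s) * ?b)"
      using x by (auto simp: ruling_line_def)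
    moreover have "cos (t - s) * cos s - sin (t - s) * sin s = cos t"
      "sin (t - s) * cos s + cos (t - s) * sin s = sin t"
      by (simp_all flip: cos_add sin_add)
    ultimately have "x $ 3 = k * (r * cos t)" "x $ 4 = k * (r * sin t)"
      unfolding ab by algebra+
    with ab show "x \<in> ray ?v"
      unfolding mem_ray by (intro exI[of _ r]) (simp add: join_vec_def unit_vec_def coords4)
  qed
qed

text \<open>Equality modulo 2 pi of the angles 4 pi i/3 and 4 pi j/3 means 2i = 2j + 3n, and 2 is
  invertible modulo 3.\<close>

lemma trine_angle_inj:
  assumes "i \<in> {0, 1, 2::int}" "j \<in> {0, 1, 2}" "i \<noteq> j"
  shows "cos (2 * of_int i * alpha) \<noteq> cos (2 * of_int j * alpha) \<or>
         sin (2 * of_int i * alpha) \<noteq> sin (2 * of_int j * alpha)"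
proof (rule ccontr)
  assume "\<not> ?thesis"
  then obtain n :: int where "2 * of_int i * alpha = 2 * of_int j * alpha + 2 * pi * of_int n"
    using sin_cos_eq_iff[of "2 * of_int i * alpha" "2 * of_int j * alpha"] by auto
  then have "pi * (2 * of_int i) = pi * (2 * of_int j + 3 * of_int n)"
    by (simp add: alpha_def field_simps)
  then have "real_of_int (2 * i) = real_of_int (2 * j + 3 * n)"
    by simp
  then have "2 * i = 2 * j + 3 * n"
    by (simp only: of_int_eq_iff)
  with assms show False by auto presburger+
qed

section \<open>Grids and dual quadrics\<close>

lemma grid_on_quadricI:
  assumes "card (F ` I) = 3" "card (G ` I) = 3"
    and "\<And>i. i \<in> I \<Longrightarrow> proj_line (F i)" "\<And>i. i \<in> I \<Longrightarrow> proj_line (G i)"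
    and "\<And>i. i \<in> I \<Longrightarrow> F i \<subseteq> quadric M" "\<And>i. i \<in> I \<Longrightarrow> G i \<subseteq> quadric M"
    and "\<And>i j. i \<in> I \<Longrightarrow> j \<in> I \<Longrightarrow> same_ruling (F i) (F j)"
    and "\<And>i j. i \<in> I \<Longrightarrow> j \<in> I \<Longrightarrow> same_ruling (G i) (G j)"
    and "\<And>i j. i \<in> I \<Longrightarrow> j \<in> I \<Longrightarrow> \<not> same_ruling (F i) (G j)"
  shows "grid_on_quadric M ((\<lambda>(i, j). F j \<inter> G i) ` (I \<times> I))"
proof -
  have eq: "(\<lambda>(i, j). F j \<inter> G i) ` (I \<times> I) = {V \<inter> W | V W. V \<in> F ` I \<and> W \<in> G ` I}"
    by auto
  show ?thesis
    unfolding grid_on_quadric_def eq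
    by (intro exI[of _ "F ` I"] exI[of _ "G ` I"] conjI refl) (simp_all add: assms ball_Un)
qed

text \<open>With s = i alpha - j beta and t = i alpha + j beta, one has t - s = 2 j beta and s + t =
  2 i alpha. Hence j alone selects the line of the rotation ruling and i alone that of the
  reflection ruling.\<close>

lemma grid_on_clifford_quadric:
  assumes k: "k \<noteq> 0"
  shows "grid_on_quadric (clifford_quadric k)
    ((\<lambda>(i, j). ray (join_vec (unit_vec (of_int i * alpha - of_int j * beta))
                     (k *\<^sub>R unit_vec (of_int i * alpha + of_int j * beta)))) ` Z3xZ3)"
proof -
  let ?I = "{0, 1, 2::int}"
  let ?L = "\<lambda>\<epsilon> i. ruling_line \<epsilon> k (2 * of_int i * alpha)"
  let ?v = "\<lambda>i j. join_vec (unit_vec (of_int i * alpha - of_int j * beta))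
                     (k *\<^sub>R unit_vec (of_int i * alpha + of_int j * beta))"
  have Int: "?L 1 j \<inter> ?L (-1) i = ray (?v i j)" for i j
    using ruling_line_Int[OF k, of "of_int i * alpha + of_int j * beta"
      "of_int i * alpha - of_int j * beta"]
    by (simp add: alpha_def beta_def algebra_simps)
  have disj: "?L \<epsilon> i \<inter> ?L \<epsilon> j = {0}"
    if "\<epsilon> = 1 \<or> \<epsilon> = -1" "i \<in> ?I" "j \<in> ?I" "i \<noteq> j" for \<epsilon> i j
    using that by (intro ruling_line_disjoint k trine_angle_inj)
  have ne0: "?L \<epsilon> i \<noteq> {0}" for \<epsilon> i
    using proj_line_ne_ray[OF proj_line_ruling_line, of _ _ _ 0] by (simp add: ray_def)
  \<comment> \<open>Equal lines at distinct indices would coincide with their intersection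
    \<open>{0}\<close>.\<close>
  have inj: "inj_on (?L \<epsilon>) ?I" if "\<epsilon> = 1 \<or> \<epsilon> = -1" for \<epsilon>
    using disj[OF that] ne0 by (intro inj_onI) (metis Int_absorb)
  have v0: "?v i j \<noteq> 0" for i j
  proof
    assume "?v i j = 0"
    then have "cos (of_int i * alpha - of_int j * beta) = 0"
      "sin (of_int i * alpha - of_int j * beta) = 0"
      by (simp_all add: join_vec_def unit_vec_def coords4)
    then show False using sin_zero_abs_cos_one by fastforce
  qed
  \<comment> \<open>The intersection is a ray with a nonzero spanning vector: nonzero excludes skew
    lines, and being only a ray excludes equal ones.\<close>
  have opp: "\<not> same_ruling (?L 1 j) (?L (-1) i)" for i j
  proof -
    have "?v i j \<in> ?L 1 j \<inter> ?L (-1) i"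
      unfolding Int by (simp add: ray_def span_base)
    then have "?L 1 j \<inter> ?L (-1) i \<noteq> {0}" using v0 by blast
    moreover have "?L 1 j \<noteq> ?L (-1) i"
      using Int[of j i] proj_line_ne_ray[OF proj_line_ruling_line] by (metis Int_absorb)
    ultimately show ?thesis by (simp add: same_ruling_def)
  qed
  have same: "same_ruling (?L \<epsilon> i) (?L \<epsilon> j)" if "\<epsilon> = 1 \<or> \<epsilon> = -1" "i \<in> ?I" "j \<in> ?I" for \<epsilon> i j
    using disj[OF that] by (auto simp: same_ruling_def)
  have card: "card (?L \<epsilon> ` ?I) = 3" if "\<epsilon> = 1 \<or> \<epsilon> = -1" for \<epsilon>
    using card_image[OF inj[OF that]] by simp
  show ?thesis
    unfolding Z3xZ3_def Int[symmetric]
  proof (rule grid_on_quadricI)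
    show "?L 1 i \<subseteq> quadric (clifford_quadric k)" "?L (-1) i \<subseteq> quadric (clifford_quadric k)" for i
      by (rule ruling_line_subset_quadric; simp)+
    show "\<not> same_ruling (?L 1 i) (?L (-1) j)" for i j
      by (rule opp)
  qed (rule card same proj_line_ruling_line; (assumption | simp))+
qed

lemma grid_on_quadric_A: "grid_on_quadric (clifford_quadric (- cc)) A_rays"
  using grid_on_clifford_quadric[of "- cc"] by (simp add: A_rays_def grid_A_def cc_def)

lemma grid_on_quadric_B: "grid_on_quadric (clifford_quadric (1 / cc)) B_rays"
proof -
  \<comment> \<open>Dividing the representative by \<open>cc\<close> gives first component a unit
    vector, which exposes the slope k = 1/\<open>cc\<close>.\<close>
  have "join_vec (cc *\<^sub>R x) y = cc *\<^sub>R join_vec x ((1 / cc) *\<^sub>R y)" for x y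
    by (simp add: join_vec_def coords4 cc_def)
  then have "ray (join_vec (cc *\<^sub>R x) y) = ray (join_vec x ((1 / cc) *\<^sub>R y))" for x y
    by (simp add: ray_scaleR cc_def)
  then show ?thesis
    using grid_on_clifford_quadric[of "1 / cc"] by (simp add: B_rays_def grid_B_def cc_def)
qed

lemma matrix_inv_eqI:
  fixes A B :: "real^'n^'n"
  assumes "A ** B = mat 1"
  shows "invertible A" "matrix_inv A = B"
proof -
  have "B ** A = mat 1" using assms by (simp add: matrix_left_right_inverse)
  with assms have ex: "\<exists>C. A ** C = mat 1 \<and> C ** A = mat 1" by blast
  then show "invertible A" by (simp add: invertible_def)
  have "matrix_inv A ** A = mat 1"
    unfolding matrix_inv_def using someI_ex[OF ex] by blast
  then have "matrix_inv A ** (A ** B) = B"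
    by (simp add: matrix_mul_assoc)
  then show "matrix_inv A = B" using assms by simp
qed

text \<open>The factors are diag(2, 2, -1, -1) and diag(1/2, 1/2, -1, -1).\<close>

lemma clifford_quadric_dual:
  "clifford_quadric (- cc) ** clifford_quadric (1 / cc) = mat 1"
  by (simp add: clifford_quadric_def coords4 matrix4 cc_def power_divide)

lemma transpose_clifford_quadric: "transpose (clifford_quadric k) = clifford_quadric k"
  by (simp add: clifford_quadric_def coords4 matrix4)

section \<open>Transport along an orthogonal matrix\<close>

lemma orthogonal_matrix_inj:
  assumes "orthogonal_matrix U"
  shows "inj ((*v) (U::real^'n^'n))"
proof (rule inj_on_inverseI)
  show "transpose U *v (U *v x) = x" for x
    using assms by (simp add: orthogonal_matrix_def matrix_vector_mul_assoc)
qed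

text \<open>As the inverse of U is its transpose, the form M pulled back along the inverse of U has
  matrix U M U^T. Injectivity of U carries intersections, and hence the ruling relation, over to the
  images.\<close>

lemma grid_on_quadric_transform:
  assumes U: "orthogonal_matrix U" and grid: "grid_on_quadric M S"
  shows "grid_on_quadric (U ** M ** transpose U) (transform_rays U S)"
proof -
  let ?f = "(*v) U"
  let ?g = "image ?f"
  have inj: "inj ?f" by (rule orthogonal_matrix_inj[OF U])
  \<comment> \<open>Injectivity on sets of vectors keeps the three lines of a ruling distinct and
    reflects equality of lines.\<close>
  then have inj_g: "inj ?g" by (rule inj_image_eq_iff[THEN iffD1, THEN injI])
  have Int: "?g V \<inter> ?g W = ?g (V \<inter> W)" for V W
    using inj by (simp add: image_Int)
  have line: "proj_line (?g V)" if "proj_line V" for V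
    using that inj by (intro proj_line_image) (auto simp: proj_line_def intro: inj_on_subset)
  have quad: "?g V \<subseteq> quadric (U ** M ** transpose U)" if "V \<subseteq> quadric M" for V
  proof -
    have "(U ** M ** transpose U) *v (U *v x) = U *v (M *v x)" for x
      using U by (simp add: orthogonal_matrix_def matrix_vector_mul_assoc flip: matrix_mul_assoc)
    moreover have "(U *v x) \<bullet> (U *v y) = x \<bullet> y" for x y
      using U orthogonal_transformation_matrix[of ?f]
      by (simp add: orthogonal_transformation_def)
    ultimately show ?thesis using that by (auto simp: quadric_def)
  qed
  have same: "same_ruling (?g V) (?g W) \<longleftrightarrow> same_ruling V W" for V W
  proof -
    have "?g {0} = {0}" by simp
    then show ?thesis unfolding same_ruling_def Int using inj_g by (metis injD)
  qed
  obtain \<V> \<W> where *: "card \<V> = 3" "card \<W> = 3"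
    "\<forall>V\<in>\<V> \<union> \<W>. proj_line V \<and> V \<subseteq> quadric M"
    "\<forall>V\<in>\<V>. \<forall>V'\<in>\<V>. same_ruling V V'" "\<forall>W\<in>\<W>. \<forall>W'\<in>\<W>. same_ruling W W'"
    "\<forall>V\<in>\<V>. \<forall>W\<in>\<W>. \<not> same_ruling V W" "S = {V \<inter> W | V W. V \<in> \<V> \<and> W \<in> \<W>}"
    using grid unfolding grid_on_quadric_def by blast
  have S: "transform_rays U S = {V \<inter> W | V W. V \<in> ?g ` \<V> \<and> W \<in> ?g ` \<W>}"
  proof (intro equalityI subsetI)
    fix r assume "r \<in> transform_rays U S"
    then obtain V W where "V \<in> \<V>" "W \<in> \<W>" "r = ?g V \<inter> ?g W"
      unfolding transform_rays_def *(7) Int by blast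
    then show "r \<in> {V \<inter> W | V W. V \<in> ?g ` \<V> \<and> W \<in> ?g ` \<W>}"
      by (intro CollectI exI[of _ "?g V"] exI[of _ "?g W"]) simp
  next
    fix r assume "r \<in> {V \<inter> W | V W. V \<in> ?g ` \<V> \<and> W \<in> ?g ` \<W>}"
    then obtain V W where "V \<in> \<V>" "W \<in> \<W>" "r = ?g (V \<inter> W)"
      unfolding Int[symmetric] by blast
    then show "r \<in> transform_rays U S"
      unfolding transform_rays_def *(7) by (intro image_eqI[of _ _ "V \<inter> W"]) blast+
  qed
  have "card (?g ` \<V>) = 3" "card (?g ` \<W>) = 3"
    using *(1,2) inj_g by (simp_all add: card_image inj_on_subset)
  then show ?thesis
    unfolding grid_on_quadric_def S using *(3-6)
    by (intro exI[of _ "?g ` \<V>"] exI[of _ "?g ` \<W>"] conjI refl)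
      (simp_all add: ball_Un line quad same)
qed

section \<open>The Peres rays\<close>

lemma vector_4_eq_iff:
  "(vector [a, b, c, d] :: 'a::zero ^ 4) = vector [a', b', c', d'] \<longleftrightarrow>
    a = a' \<and> b = b' \<and> c = c' \<and> d = d'"
  by (auto simp: coords4)

text \<open>Leading nonzero coordinate 1: a normal form for spanning vectors, satisfied by all
  listed Peres vectors, that reduces equality of rays to equality of vectors.\<close>

definition monic :: "real^4 \<Rightarrow> bool" where
  "monic x \<longleftrightarrow> x $ 1 = 1 \<or> x $ 1 = 0 \<and>
    (x $ 2 = 1 \<or> x $ 2 = 0 \<and> (x $ 3 = 1 \<or> x $ 3 = 0 \<and> x $ 4 = 1))"

lemma ray_eq_iff_monic:
  assumes "monic v" "monic w"
  shows "ray v = ray w \<longleftrightarrow> v = w"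
proof
  assume "ray v = ray w"
  then have "v \<in> ray w" by (metis ray_def span_base singletonI)
  then obtain c where c: "v = c *\<^sub>R w" by (auto simp: mem_ray)
  have "c = 1" using assms unfolding c monic_def by (elim disjE conjE) simp_all
  then show "v = w" by (simp add: c)
qed simp

text \<open>The first index appears as \<open>Suc 0\<close> because that is the simplifier's form of
  the natural number 1.\<close>

lemma peres_eval:
  "peres (Suc 0) = ray (vector [1, 0, 0, 0])" "peres 2 = ray (vector [0, 1, 0, 0])"
  "peres 3 = ray (vector [0, 0, 1, 0])" "peres 4 = ray (vector [0, 0, 0, 1])"
  "peres 5 = ray (vector [1, 1, 1, 1])" "peres 6 = ray (vector [1, 1, -1, -1])"
  "peres 7 = ray (vector [1, -1, 1, -1])" "peres 8 = ray (vector [1, -1, -1, 1])"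
  "peres 9 = ray (vector [1, 1, 1, -1])" "peres 10 = ray (vector [1, 1, -1, 1])"
  "peres 11 = ray (vector [1, -1, 1, 1])" "peres 12 = ray (vector [1, -1, -1, -1])"
  "peres 13 = ray (vector [1, 1, 0, 0])" "peres 14 = ray (vector [1, -1, 0, 0])"
  "peres 15 = ray (vector [0, 0, 1, 1])" "peres 16 = ray (vector [0, 0, 1, -1])"
  "peres 17 = ray (vector [0, 1, 0, 1])" "peres 18 = ray (vector [0, 1, 0, -1])"
  "peres 19 = ray (vector [1, 0, 1, 0])" "peres 20 = ray (vector [1, 0, -1, 0])"
  "peres 21 = ray (vector [1, 0, 0, 1])" "peres 22 = ray (vector [1, 0, 0, -1])"
  "peres 23 = ray (vector [0, 1, 1, 0])" "peres 24 = ray (vector [0, 1, -1, 0])"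
  by (simp_all add: peres_def)

lemma inj_on_peres: "inj_on peres {1..24}"
proof -
  let ?xs = "[1, 2, 3, 4, 5, 6, 7, 8, 9, 10, 11, 12, 13, 14, 15, 16, 17, 18, 19, 20, 21, 22, 23,
    24::nat]"
  have "distinct (map peres ?xs)"
    by (simp add: peres_eval ray_eq_iff_monic monic_def vector_4 vector_4_eq_iff)
  then have "inj_on peres (set ?xs)"
    unfolding distinct_map by blast
  moreover have "set ?xs = {1..24}"
    by code_simp
  ultimately show ?thesis by (simp only:)
qed

section \<open>The orthogonal equivalence\<close>

text \<open>The first two columns span the plane of the trisecant \<open>{P\<^sub>1, P\<^sub>5, P\<^sub>1\<^sub>2}\<close> and the last two that
  of \<open>{P\<^sub>1\<^sub>6, P\<^sub>1\<^sub>8, P\<^sub>2\<^sub>4}\<close>. The unit vectors at angles \<open>0\<close>, \<open>2\<pi>/3\<close> and \<open>4\<pi>/3\<close> go, up to sign,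
  to the normalized projections of the remaining Peres vectors onto these two orthogonal planes.\<close>

definition cabello_matrix :: "real^4^4" where
  "cabello_matrix = vector [vector [0, 1, 0, 0],
     vector [sqrt 3 / 3, 0, - (sqrt 2 * sqrt 3 / 3), 0],
     vector [sqrt 3 / 3, 0, sqrt 2 * sqrt 3 / 6, sqrt 2 / 2],
     vector [sqrt 3 / 3, 0, sqrt 2 * sqrt 3 / 6, - (sqrt 2 / 2)]]"

lemma sqrt_mult_self_left:
  "sqrt 2 * (sqrt 2 * x) = 2 * x" "sqrt 3 * (sqrt 3 * x) = 3 * x"
  by (simp_all flip: mult.assoc)

lemma orthogonal_cabello_matrix: "orthogonal_matrix cabello_matrix"
  unfolding orthogonal_matrix
  by (simp add: cabello_matrix_def
    coords4 matrix4 sqrt_mult_self_left mult.assoc mult.left_commute[of "sqrt 3" "sqrt 2"])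

lemma unit_vec_mod_3: "unit_vec (of_int (n mod 3) * alpha) = unit_vec (of_int n * alpha)"
  using unit_vec_mod(1)[of n 0] by simp

lemma beta_eq_alpha: "beta = alpha"
  by (simp add: alpha_def beta_def)

text \<open>As \<open>alpha\<close> and \<open>beta\<close> coincide, both angles are multiples of 2
  pi/3; reduction modulo 3 leaves only the three vectors in \<open>trine_eval\<close>.\<close>

lemma grid_A_trine:
  "grid_A i j = ray (join_vec (unit_vec (of_int ((i - j) mod 3) * alpha))
                              (- sqrt 2 *\<^sub>R unit_vec (of_int ((i + j) mod 3) * alpha)))"
  by (simp add: unit_vec_mod_3 grid_A_def cc_def beta_eq_alpha left_diff_distrib distrib_right)

lemma grid_B_trine:
  "grid_B i j = ray (join_vec (sqrt 2 *\<^sub>R unit_vec (of_int ((i - j) mod 3) * alpha))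
                              (unit_vec (of_int ((i + j) mod 3) * alpha)))"
  by (simp add: unit_vec_mod_3 grid_B_def cc_def beta_eq_alpha left_diff_distrib distrib_right)

lemma trine_eval:
  "unit_vec 0 = vector [1, 0]"
  "unit_vec alpha = vector [- 1 / 2, sqrt 3 / 2]"
  "unit_vec (2 * alpha) = vector [- 1 / 2, - sqrt 3 / 2]"
proof -
  have "2 * alpha = alpha + alpha" by simp
  then have "cos (2 * alpha) = - 1 / 2" "sin (2 * alpha) = - sqrt 3 / 2"
    by (simp_all only: cos_add sin_add) (simp_all add: alpha_def cos_120 sin_120)
  then show "unit_vec (2 * alpha) = vector [- 1 / 2, - sqrt 3 / 2]"
    by (simp add: unit_vec_def)
qed (simp_all add: unit_vec_def alpha_def cos_120 sin_120)

lemma ray_eqI: "v = c *\<^sub>R w \<Longrightarrow> c \<noteq> 0 \<Longrightarrow> ray v = ray w"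
  by (simp add: ray_scaleR)

lemmas cabello_matrix_mult =
  cabello_matrix_def join_vec_def trine_eval trine_eval(3)[unfolded mult.commute[of 2]]
    coords4 matrix4 sqrt_mult_self_left algebra_simps

lemma image_grid_A:
  "(*v) cabello_matrix ` grid_A 0 0 = peres 2"
  "(*v) cabello_matrix ` grid_A 0 1 = peres 9"
  "(*v) cabello_matrix ` grid_A 0 2 = peres 7"
  "(*v) cabello_matrix ` grid_A 1 0 = peres 8"
  "(*v) cabello_matrix ` grid_A 1 1 = peres 3"
  "(*v) cabello_matrix ` grid_A 1 2 = peres 11"
  "(*v) cabello_matrix ` grid_A 2 0 = peres 10"
  "(*v) cabello_matrix ` grid_A 2 1 = peres 6"
  "(*v) cabello_matrix ` grid_A 2 2 = peres 4"
  unfolding grid_A_trine image_ray peres_eval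
  \<comment> \<open>The grid vectors have norm sqrt 3 and the Peres vectors of D have norm 1 or 2,
    so the factors are sqrt 3 or sqrt 3/2 up to sign.\<close>
  subgoal by (rule ray_eqI[of _ "sqrt 3"]) (simp_all add: cabello_matrix_mult)
  subgoal by (rule ray_eqI[of _ "- (sqrt 3 / 2)"]) (simp_all add: cabello_matrix_mult)
  subgoal by (rule ray_eqI[of _ "sqrt 3 / 2"]) (simp_all add: cabello_matrix_mult)
  subgoal by (rule ray_eqI[of _ "sqrt 3 / 2"]) (simp_all add: cabello_matrix_mult)
  subgoal by (rule ray_eqI[of _ "sqrt 3"]) (simp_all add: cabello_matrix_mult)
  subgoal by (rule ray_eqI[of _ "- (sqrt 3 / 2)"]) (simp_all add: cabello_matrix_mult)
  subgoal by (rule ray_eqI[of _ "- (sqrt 3 / 2)"]) (simp_all add: cabello_matrix_mult)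
  subgoal by (rule ray_eqI[of _ "sqrt 3 / 2"]) (simp_all add: cabello_matrix_mult)
  subgoal by (rule ray_eqI[of _ "sqrt 3"]) (simp_all add: cabello_matrix_mult)
  done

lemma image_grid_B:
  "(*v) cabello_matrix ` grid_B 0 0 = peres 15"
  "(*v) cabello_matrix ` grid_B 0 1 = peres 21"
  "(*v) cabello_matrix ` grid_B 0 2 = peres 20"
  "(*v) cabello_matrix ` grid_B 1 0 = peres 22"
  "(*v) cabello_matrix ` grid_B 1 1 = peres 17"
  "(*v) cabello_matrix ` grid_B 1 2 = peres 13"
  "(*v) cabello_matrix ` grid_B 2 0 = peres 19"
  "(*v) cabello_matrix ` grid_B 2 1 = peres 14"
  "(*v) cabello_matrix ` grid_B 2 2 = peres 23"
  unfolding grid_B_trine image_ray peres_eval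
  \<comment> \<open>Here the norms are sqrt 3 and sqrt 2, so every factor is sqrt 6/2 up to
    sign.\<close>
  subgoal by (rule ray_eqI[of _ "sqrt 2 * sqrt 3 / 2"]) (simp_all add: cabello_matrix_mult)
  subgoal by (rule ray_eqI[of _ "- (sqrt 2 * sqrt 3 / 2)"]) (simp_all add: cabello_matrix_mult)
  subgoal by (rule ray_eqI[of _ "sqrt 2 * sqrt 3 / 2"]) (simp_all add: cabello_matrix_mult)
  subgoal by (rule ray_eqI[of _ "sqrt 2 * sqrt 3 / 2"]) (simp_all add: cabello_matrix_mult)
  subgoal by (rule ray_eqI[of _ "sqrt 2 * sqrt 3 / 2"]) (simp_all add: cabello_matrix_mult)
  subgoal by (rule ray_eqI[of _ "- (sqrt 2 * sqrt 3 / 2)"]) (simp_all add: cabello_matrix_mult)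
  subgoal by (rule ray_eqI[of _ "- (sqrt 2 * sqrt 3 / 2)"]) (simp_all add: cabello_matrix_mult)
  subgoal by (rule ray_eqI[of _ "sqrt 2 * sqrt 3 / 2"]) (simp_all add: cabello_matrix_mult)
  subgoal by (rule ray_eqI[of _ "sqrt 2 * sqrt 3 / 2"]) (simp_all add: cabello_matrix_mult)
  done

section \<open>Images of the contexts and of the whole configuration\<close>

lemma context_C_mod:
  "context_C i j = {grid_A i j, grid_A ((i - 1) mod 3) ((j - 1) mod 3),
    grid_B i ((j - 1) mod 3), grid_B ((i - 1) mod 3) j}"
  using grid_B_mod[of i "j - 1"] grid_B_mod[of "i - 1" j] grid_B_mod[of i "(j - 1) mod 3"]
    grid_B_mod[of "(i - 1) mod 3" j]
  by (simp add: context_C_def grid_A_mod)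

lemma image_context_C:
  "transform_rays cabello_matrix (context_C 0 0) = peres ` {2, 4, 19, 20}"
  "transform_rays cabello_matrix (context_C 0 1) = peres ` {9, 10, 14, 15}"
  "transform_rays cabello_matrix (context_C 0 2) = peres ` {6, 7, 21, 23}"
  "transform_rays cabello_matrix (context_C 1 0) = peres ` {7, 8, 13, 15}"
  "transform_rays cabello_matrix (context_C 1 1) = peres ` {2, 3, 21, 22}"
  "transform_rays cabello_matrix (context_C 1 2) = peres ` {9, 11, 17, 20}"
  "transform_rays cabello_matrix (context_C 2 0) = peres ` {10, 11, 22, 23}"
  "transform_rays cabello_matrix (context_C 2 1) = peres ` {6, 8, 17, 19}"
  "transform_rays cabello_matrix (context_C 2 2) = peres ` {3, 4, 13, 14}"
  \<comment> \<open>Reduction modulo 3 brings the shifted indices into 0, 1, 2, where the images are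
    tabulated.\<close>
  unfolding context_C_mod transform_rays_def
  by (simp_all add: image_grid_A image_grid_B insert_commute)

lemma Z3xZ3_eval: "Z3xZ3 = {(0, 0), (0, 1), (0, 2), (1, 0), (1, 1), (1, 2), (2, 0), (2, 1), (2, 2)}"
  by (auto simp: Z3xZ3_def)

lemma transform_A_rays: "transform_rays cabello_matrix A_rays
  = peres ` {2, 3, 4, 6, 7, 8, 9, 10, 11}"
  by (simp add: transform_rays_def A_rays_def Z3xZ3_eval image_grid_A insert_commute)

lemma transform_B_rays: "transform_rays cabello_matrix B_rays
  = peres ` {13, 14, 15, 17, 19, 20, 21, 22, 23}"
  by (simp add: transform_rays_def B_rays_def Z3xZ3_eval image_grid_B insert_commute)

lemma transform_Z33: "transform_rays cabello_matrix Z33 = peres ` ({2, 3, 4, 6, 7, 8, 9, 10, 11}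
  \<union> {13, 14, 15, 17, 19, 20, 21, 22, 23})"
  unfolding image_Un transform_A_rays[symmetric] transform_B_rays[symmetric]
  by (simp add: Z33_def transform_rays_def image_Un)

lemma cabello_rays_eval: "cabello_rays = peres ` ({2, 3, 4, 6, 7, 8, 9, 10, 11}
  \<union> {13, 14, 15, 17, 19, 20, 21, 22, 23})"
proof -
  have "cabello_rays = peres ` \<Union> {{2, 3, 21, 22}, {9, 10, 14, 15}, {6, 8, 17, 19},
      {7, 8, 13, 15}, {2, 4, 19, 20}, {10, 11, 22, 23},
      {9, 11, 17, 20}, {6, 7, 21, 23}, {3, 4, 13, 14}}"
    by (simp only: cabello_rays_def cabello_contexts_def image_Union)
  also have "\<Union> {{2, 3, 21, 22}, {9, 10, 14, 15}, {6, 8, 17, 19},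
      {7, 8, 13, 15}, {2, 4, 19, 20}, {10, 11, 22, 23},
      {9, 11, 17, 20}, {6, 7, 21, 23}, {3, 4, 13, 14}} = ({2, 3, 4, 6, 7, 8, 9, 10, 11}
        \<union> {13, 14, 15, 17, 19, 20, 21, 22, 23} :: nat set)"
    by code_simp
  finally show ?thesis .
qed

text \<open>Surjectivity is read off the table. Injectivity follows by counting:
  \<open>peres\<close> is injective on 1..24, so the nine Cabello contexts are distinct, as many as
  there are index pairs.\<close>

lemma bij_betw_contexts:
  "bij_betw (\<lambda>(i, j). transform_rays cabello_matrix (context_C i j)) Z3xZ3 cabello_contexts"
    (is "bij_betw ?f _ _")
proof -
  let ?S = "{{2, 3, 21, 22}, {9, 10, 14, 15}, {6, 8, 17, 19},
      {7, 8, 13, 15}, {2, 4, 19, 20}, {10, 11, 22, 23},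
      {9, 11, 17, 20}, {6, 7, 21, 23}, {3, 4, 13, 14::nat}}"
  have "?f ` Z3xZ3 = (`) peres ` {{2, 4, 19, 20}, {9, 10, 14, 15}, {6, 7, 21, 23},
      {7, 8, 13, 15}, {2, 3, 21, 22},
      {9, 11, 17, 20}, {10, 11, 22, 23}, {6, 8, 17, 19}, {3, 4, 13, 14}}"
    by (simp only: Z3xZ3_eval image_insert image_empty case_prod_conv image_context_C)
  also have "{{2, 4, 19, 20}, {9, 10, 14, 15}, {6, 7, 21, 23},
      {7, 8, 13, 15}, {2, 3, 21, 22},
      {9, 11, 17, 20}, {10, 11, 22, 23}, {6, 8, 17, 19}, {3, 4, 13, 14}} = ?S"
    by code_simp
  finally have image: "?f ` Z3xZ3 = cabello_contexts"
    by (simp only: cabello_contexts_def)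
  have "?S \<subseteq> Pow {1..24}" by simp
  then have "inj_on ((`) peres) ?S"
    by (rule inj_on_subset[OF inj_on_image_Pow[OF inj_on_peres]])
  then have "card cabello_contexts = card ?S"
    unfolding cabello_contexts_def by (rule card_image)
  also have "card ?S = 9" by code_simp
  finally have "card (?f ` Z3xZ3) = card Z3xZ3"
    unfolding image by (simp add: Z3xZ3_def)
  moreover have "finite Z3xZ3" by (simp add: Z3xZ3_def)
  ultimately show ?thesis
    using image by (simp add: bij_betw_def eq_card_imp_inj_on)
qed

section \<open>The mutually polar trisecants\<close>

lemma peres_D_eval: "peres_D = peres ` {1, 2, 3, 4, 5, 6, 7, 8, 9, 10, 11, 12}"
proof -
  have "{1..12} = {1, 2, 3, 4, 5, 6, 7, 8, 9, 10, 11, 12::nat}" by code_simp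
  then show ?thesis by (simp only: peres_D_def)
qed

lemma peres_D'_eval: "peres_D' = peres ` {13, 14, 15, 16, 17, 18, 19, 20, 21, 22, 23, 24}"
proof -
  have "{13..24} = {13, 14, 15, 16, 17, 18, 19, 20, 21, 22, 23, 24::nat}" by code_simp
  then show ?thesis by (simp only: peres_D'_def)
qed

text \<open>The plane W is spanned by P1 and P5: its last three coordinates agree, and among the
  twelve vectors of D only P1, P5 and P12 have this property.\<close>

lemma trisecant_D: "trisecant peres_D (peres ` {1, 5, 12})"
proof -
  let ?f = "\<lambda>x::real^2. vector [x $ 1, x $ 2, x $ 2, x $ 2] :: real^4"
  define W where "W = range ?f"
  have mem: "vector [a, b, c, d] \<in> W \<longleftrightarrow> b = c \<and> c = d" for a b c d
    unfolding W_def image_iff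
    by (auto simp: vector_4_eq_iff intro: exI[of _ "vector [a, d]"])
  have lin: "linear ?f"
    by (rule linearI) (simp_all add: coords4)
  have "proj_line W"
    unfolding W_def by (rule proj_line_image[OF lin]) (auto simp: inj_on_def coords4 forall_2)
  moreover have "card (peres ` {1, 5, 12}) = 3"
    using card_image[OF inj_on_subset[OF inj_on_peres, of "{1, 5, 12}"]] by simp
  moreover have "peres ` {1, 5, 12} = {r \<in> peres_D. r \<subseteq> W}"
  proof -
    have "subspace W" using \<open>proj_line W\<close> by (simp add: proj_line_def)
    note sub = ray_subset_iff[OF this]
    show ?thesis
      unfolding peres_D_eval by (intro set_eqI) (auto simp: peres_eval sub mem del: subsetI)
  qed
  ultimately show ?thesis unfolding trisecant_def by blast
qed

text \<open>The plane W is the orthogonal complement of the one spanned by P1 and P5, cut out by a =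
  0 and b + c + d = 0.\<close>

lemma trisecant_D': "trisecant peres_D' (peres ` {16, 18, 24})"
proof -
  let ?f = "\<lambda>x::real^2. vector [0, x $ 1, x $ 2, - x $ 1 - x $ 2] :: real^4"
  define W where "W = range ?f"
  have mem: "vector [a, b, c, d] \<in> W \<longleftrightarrow> a = 0 \<and> b + c + d = 0" for a b c d
    unfolding W_def image_iff
    by (auto simp: vector_4_eq_iff intro: exI[of _ "vector [b, c]"])
  have lin: "linear ?f"
    by (rule linearI) (simp_all add: coords4 algebra_simps)
  have "proj_line W"
    unfolding W_def by (rule proj_line_image[OF lin]) (auto simp: inj_on_def coords4 forall_2)
  moreover have "card (peres ` {16, 18, 24}) = 3"
    using card_image[OF inj_on_subset[OF inj_on_peres, of "{16, 18, 24}"]] by simp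
  moreover have "peres ` {16, 18, 24} = {r \<in> peres_D'. r \<subseteq> W}"
  proof -
    have "subspace W" using \<open>proj_line W\<close> by (simp add: proj_line_def)
    note sub = ray_subset_iff[OF this]
    show ?thesis
      unfolding peres_D'_eval by (intro set_eqI) (auto simp: peres_eval sub mem del: subsetI)
  qed
  ultimately show ?thesis unfolding trisecant_def by blast
qed

lemma mutually_polar_trisecants: "mutually_polar (peres ` {1, 5, 12}) (peres ` {16, 18, 24})"
  unfolding mutually_polar_def
  by (simp add: peres_eval ray_orthogonal_ray inner_vec_def sum_4 vector_4)

text \<open>Injectivity of \<open>peres\<close> lets the set differences be computed on
  indices.\<close>

lemma peres_minus_trisecants:
  "(peres_D - peres ` {1, 5, 12}) \<union> (peres_D' - peres ` {16, 18, 24})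
    = peres ` ({2, 3, 4, 6, 7, 8, 9, 10, 11} \<union> {13, 14, 15, 17, 19, 20, 21, 22, 23})"
proof -
  have "peres_D - peres ` {1, 5, 12} = peres ` ({1..12} - {1, 5, 12})"
    unfolding peres_D_def by (rule inj_on_image_set_diff[OF inj_on_peres, symmetric]) auto
  moreover have "peres_D' - peres ` {16, 18, 24} = peres ` ({13..24} - {16, 18, 24})"
    unfolding peres_D'_def by (rule inj_on_image_set_diff[OF inj_on_peres, symmetric]) auto
  moreover have "{1..12} - {1, 5, 12} = ({2, 3, 4, 6, 7, 8, 9, 10, 11} :: nat set)"
    "{13..24} - {16, 18, 24} = ({13, 14, 15, 17, 19, 20, 21, 22, 23} :: nat set)"
    by code_simp+
  ultimately show ?thesis by (simp only: image_Un)
qed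

theorem theorem5p2:
  shows "orthogonally_equivalent Z33 cabello_rays \<and>
    (\<exists>L L' U. trisecant peres_D L \<and> trisecant peres_D' L' \<and> mutually_polar L L' \<and>
       orthogonal_matrix U \<and>
       transform_rays U Z33 = (peres_D - L) \<union> (peres_D' - L') \<and>
       (\<exists>M. smooth_quadric M \<and>
          grid_on_quadric M (transform_rays U A_rays) \<and>
          grid_on_quadric (matrix_inv M) (transform_rays U B_rays)) \<and>
       bij_betw (\<lambda>(i, j). transform_rays U (context_C i j)) Z3xZ3 cabello_contexts)"
proof (intro conjI exI)
  let ?U = cabello_matrix and ?M = "clifford_quadric (- cc)"
  let ?N = "?U ** ?M ** transpose ?U"
  show "orthogonally_equivalent Z33 cabello_rays"
    unfolding orthogonally_equivalent_def
    using orthogonal_cabello_matrix transform_Z33 cabello_rays_eval by metis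
  show "trisecant peres_D (peres ` {1, 5, 12})" "trisecant peres_D' (peres ` {16, 18, 24})"
    "mutually_polar (peres ` {1, 5, 12}) (peres ` {16, 18, 24})" "orthogonal_matrix ?U"
    by (fact trisecant_D trisecant_D' mutually_polar_trisecants orthogonal_cabello_matrix)+
  show "transform_rays ?U Z33 = (peres_D - peres ` {1, 5, 12}) \<union> (peres_D' - peres ` {16, 18, 24})"
    unfolding peres_minus_trisecants by (rule transform_Z33)
  have U: "transpose ?U ** ?U = mat 1" "?U ** transpose ?U = mat 1"
    using orthogonal_cabello_matrix by (simp_all add: orthogonal_matrix_def)
  \<comment> \<open>Euclidean duality commutes with orthogonal maps: the inverse of U M U^T is U
    M^(-1) U^T, since the inner factors U^T U cancel.\<close>
  have "?N ** (?U ** clifford_quadric (1 / cc) ** transpose ?U)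
      = ?U ** ?M ** (transpose ?U ** ?U) ** clifford_quadric (1 / cc) ** transpose ?U"
    by (simp only: matrix_mul_assoc)
  also have "\<dots> = ?U ** (?M ** clifford_quadric (1 / cc)) ** transpose ?U"
    unfolding U(1) by (simp only: matrix_mul_rid matrix_mul_assoc)
  also have "\<dots> = mat 1"
    by (simp add: clifford_quadric_dual U)
  finally have inv: "invertible ?N"
    "matrix_inv ?N = ?U ** clifford_quadric (1 / cc) ** transpose ?U"
    by (rule matrix_inv_eqI)+
  show "smooth_quadric ?N"
    using inv(1) by (simp add: smooth_quadric_def matrix_transpose_mul
      transpose_clifford_quadric matrix_mul_assoc)
  show "grid_on_quadric ?N (transform_rays ?U A_rays)"
    by (rule grid_on_quadric_transform[OF orthogonal_cabello_matrix grid_on_quadric_A])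
  show "grid_on_quadric (matrix_inv ?N) (transform_rays ?U B_rays)"
    unfolding inv(2) by (rule grid_on_quadric_transform[OF orthogonal_cabello_matrix
      grid_on_quadric_B])
  show "bij_betw (\<lambda>(i, j). transform_rays ?U (context_C i j)) Z3xZ3 cabello_contexts"
    by (rule bij_betw_contexts)
qed

end
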